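(* The DRCC-OTS problem under the mean-mean absolute deviation ambiguity set $\mathcal P_1$, i.e. the problem of minimizing $\boldsymbol c^{\mathsf T}\boldsymbol g+\mathbb E[\boldsymbol q^{\mathsf T}\boldsymbol\gamma\mathbf e^{\mathsf T}\boldsymbol\xi]$ over decisions $\mathbf x$ satisfying the deterministic constraints (D) and the distributionally robust chance constraints $$\inf_{\mathbb P\in\mathcal P_1}\mathbb P\{\mathbf a_i(\mathbf x)^{\mathsf T}\boldsymbol\xi\le b_i(\mathbf x)\}\ge 1-\epsilon_i\qquad\forall i\in\mathcal I,$$ is equivalent to the following optimization problem (same objective, and the same feasible decisions $\mathbf x$ once the auxiliary variables are projected out): $$\min\ \boldsymbol c^{\mathsf T}\boldsymbol g+\mathbb E[\boldsymbol q^{\mathsf T}\boldsymbol\gamma\mathbf e^{\mathsf T}\boldsymbol\xi]$$ subject to the constraints (D) and, for every $i\in\mathcal I$ with its own auxiliary variables $\alpha'\in\mathbb R$, $\boldsymbol\beta'\in\mathbb R^K$, $\boldsymbol\kappa'\in\mathbb R_+^K$, $\lambda'\in\mathbb R_+$, $\boldsymbol\pi_1',\boldsymbol\pi_2',\boldsymbol\tau_1',\boldsymbol\tau_2'\in\mathbb R_+^K$, $\boldsymbol\psi_1',\boldsymbol\psi_2'\in\mathbb R_+^W$, the constraints $$\begin{aligned} &\alpha'+\boldsymbol\beta'^{\mathsf T}\boldsymbol\mu-\boldsymbol\kappa'^{\mathsf T}\boldsymbol\sigma\ge(1-\epsilon_i)\lambda',\\ &\alpha'+(\boldsymbol\pi_1'-\boldsymbol\tau_1')^{\mathsf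 T}\boldsymbol\mu+\boldsymbol\psi_1'^{\mathsf T}\mathbf t\le\lambda',\\ &\boldsymbol\beta'^{\mathsf T}+\boldsymbol\tau_1'^{\mathsf T}=\boldsymbol\pi_1'^{\mathsf T}+\boldsymbol\psi_1'^{\mathsf T}\mathbf U,\\ &\boldsymbol\pi_1'^{\mathsf T}+\boldsymbol\tau_1'^{\mathsf T}=\boldsymbol\kappa'^{\mathsf T},\\ &\alpha'+(\boldsymbol\pi_2'-\boldsymbol\tau_2')^{\mathsf T}\boldsymbol\mu+\boldsymbol\psi_2'^{\mathsf T}\mathbf t\le b_i(\mathbf x),\\ &\boldsymbol\beta'^{\mathsf T}+\mathbf a_i(\mathbf x)^{\mathsf T}+\boldsymbol\tau_2'^{\mathsf T}=\boldsymbol\pi_2'^{\mathsf T}+\boldsymbol\psi_2'^{\mathsf T}\mathbf U,\\ &\boldsymbol\pi_2'^{\mathsf T}+\boldsymbol\tau_2'^{\mathsf T}=\boldsymbol\kappa'^{\mathsf T}. \end{aligned}$$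
   Context: Notation: $\circ$ is the component-wise product, $|\cdot|$ and vector inequalities are component-wise, $\mathbf e$ is the all-ones vector, and $\mathcal P_0(\boldsymbol\Xi)$ is the set of all probability distributions supported on $\boldsymbol\Xi$. Uncertainty: $\boldsymbol\xi\in\mathbb R^K$ has support $\boldsymbol\Xi=\{\boldsymbol\xi\in\mathbb R^K:\mathbf U\boldsymbol\xi\le\mathbf t\}$, a compact full-dimensional polytope, with $\mathbf U\in\mathbb R^{W\times K}$, $\mathbf t\in\mathbb R^W$. The mean $\mathbb E[\boldsymbol\xi]=\boldsymbol\mu$ is known, so that the second term of the objective equals $\boldsymbol q^{\mathsf T}\boldsymbol\gamma\,\mathbf e^{\mathsf T}\boldsymbol\mu$. The ambiguity set is $$\mathcal P_1=\{\mathbb P\in\mathcal P_0(\boldsymbol\Xi):\ \mathbb E[\boldsymbol\xi]=\boldsymbol\mu,\ \mathbb E[|\boldsymbol\xi-\boldsymbol\mu|]\le\boldsymbol\sigma\},\qquad \boldsymbol\mu\in\mathbb R^K,\ \boldsymbol\sigma\in\mathbb R_+^K,$$ and it satisfies Slater's condition, i.e. $\boldsymbol\mu$ lies in the interior of $\boldsymbol\Xi$ and every component of $\boldsymbol\sigma$ is positive. Network data: $N$ buses, $L$ lines; incidence matrix $\mathbf A\in\mathbb Z^{N\times L}$ (column $\mathbf e_i-\mathbf e_j$ for line $(i,j)$); $\mathbf K\in\mathbb R^{L\times N}$ (row $b_{ij}(\mathbf e_i-\mathbf e_j)^{\mathsf T}$, $b_{ij}$ the inverse line reactance); load $\boldsymbol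 d\in\mathbb R^N$; cost vectors $\boldsymbol c,\boldsymbol q\in\mathbb R^N$; bounds $\underline{\boldsymbol g},\overline{\boldsymbol g},\underline{\boldsymbol\theta},\overline{\boldsymbol\theta},\underline{\boldsymbol r},\overline{\boldsymbol r}\in\mathbb R^N$ and $\underline{\boldsymbol f},\overline{\boldsymbol f}\in\mathbb R^L$; big-M vector $\mathbf M\in\mathbb R^L$ with sufficiently large entries; maximal number $L_o$ of open lines; matrix $\mathbf F\in\mathbb R^{N\times K}$ mapping the uncertainty to the buses; tolerances $\epsilon_i\in(0,1)$. Decisions $\mathbf x$: $\boldsymbol g,\boldsymbol\theta\in\mathbb R^N$, $\boldsymbol f\in\mathbb R^L$, $\boldsymbol z\in\{0,1\}^L$, $\boldsymbol\gamma\in[0,1]^N$, together with the recourse matrices $\boldsymbol Y_\theta\in\mathbb R^{N\times K}$, $\boldsymbol Y_f\in\mathbb R^{L\times K}$ and the dual matrices $\boldsymbol\Phi_1,\boldsymbol\Phi_2\in\mathbb R_+^{W\times L}$. Constraints (D): - $\mathbf e^{\mathsf T}\boldsymbol\gamma=1$; $\underline{\boldsymbol g}\le\boldsymbol g\le\overline{\boldsymbol g}$; $\underline{\boldsymbol\theta}\le\boldsymbol\theta\le\overline{\boldsymbol\theta}$; $\underline{\boldsymbol f}\circ\boldsymbol z\le\boldsymbol f\le\overline{\boldsymbol f}\circ\boldsymbol z$; $\mathbf A\boldsymbol f=\boldsymbol g-\boldsymbol d$; - $\mathbf K\boldsymbol\theta-\boldsymbol f+\mathbf M\circ(\mathbf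 e-\boldsymbol z)\ge\mathbf 0$; $\mathbf K\boldsymbol\theta-\boldsymbol f-\mathbf M\circ(\mathbf e-\boldsymbol z)\le\mathbf 0$; $\mathbf e^{\mathsf T}\boldsymbol z\ge L-L_o$; - $\mathbf A\boldsymbol Y_f=\boldsymbol\gamma\mathbf e^{\mathsf T}-\mathbf F$; - $\boldsymbol Y_f=\mathbf K\boldsymbol Y_\theta+\boldsymbol\Phi_1^{\mathsf T}\mathbf U$ and $\mathbf K\boldsymbol\theta+\mathbf M\circ(\mathbf e-\boldsymbol z)-\boldsymbol\Phi_1^{\mathsf T}\mathbf t\ge\boldsymbol f$; - $\boldsymbol Y_f=\mathbf K\boldsymbol Y_\theta-\boldsymbol\Phi_2^{\mathsf T}\mathbf U$ and $\mathbf M\circ(\mathbf e-\boldsymbol z)-\boldsymbol\Phi_2^{\mathsf T}\mathbf t+\boldsymbol f\ge\mathbf K\boldsymbol\theta$. Chance-constrained inequalities: $\mathcal I$ indexes the scalar inequalities contained in $$\underline{\boldsymbol r}\le\boldsymbol\gamma\mathbf e^{\mathsf T}\boldsymbol\xi\le\overline{\boldsymbol r},\quad \underline{\boldsymbol g}\le\boldsymbol g+\boldsymbol\gamma\mathbf e^{\mathsf T}\boldsymbol\xi\le\overline{\boldsymbol g},\quad \underline{\boldsymbol\theta}\le\boldsymbol\theta+\boldsymbol Y_\theta\boldsymbol\xi\le\overline{\boldsymbol\theta},\quad \underline{\boldsymbol f}\circ\boldsymbol z\le\boldsymbol f+\boldsymbol Y_f\boldsymbol\xi\le\overline{\boldsymbol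 f}\circ\boldsymbol z;$$ each is written as $\mathbf a_i(\mathbf x)^{\mathsf T}\boldsymbol\xi\le b_i(\mathbf x)$ with $\mathbf a_i(\mathbf x)\in\mathbb R^K$ and $b_i(\mathbf x)\in\mathbb R$ affine in $\mathbf x$. *)

theory Defs
  imports "HOL-Probability.Probability"
begin

text \<open>
  Vectors and matrices are \<^typ>\<open>real ^ 'n\<close> and \<^typ>\<open>real ^ 'n ^ 'm\<close> (\<open>m\<close> rows, \<open>n\<close> columns).  On these
  types \<open>\<le>\<close>, \<open>*\<close> and the absolute value are component-wise and \<open>1\<close> is the all-ones vector, so
  \<open>1 \<bullet> v\<close> is the sum of the components of \<open>v\<close>.
\<close>

section \<open>Data and decisions\<close>

text \<open>
  The index set of the scalar chance-constrained inequalities: lower and upper bounds on the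
  reserve, generation and angle of each bus and on the flow of each line.
\<close>

datatype ('n, 'l) cc_index =
    R_lower 'n | R_upper 'n
  | G_lower 'n | G_upper 'n
  | Theta_lower 'n | Theta_upper 'n
  | F_lower 'l | F_upper 'l

text \<open>
  Type parameters: buses \<open>'n\<close>, lines \<open>'l\<close>, components of the uncertainty \<open>'k\<close>, and facets
  of its support \<open>'w\<close>.  Line \<open>l\<close> goes from bus \<open>line_from l\<close> to bus \<open>line_to l\<close> and
  \<open>line_b l\<close> is its inverse reactance.
\<close>

record ('n::finite, 'l::finite, 'k::finite, 'w::finite) ots_data =
  U_mat :: "real ^ 'k ^ 'w"
  t_vec :: "real ^ 'w"
  mu_vec :: "real ^ 'k"
  sigma_vec :: "real ^ 'k"
  line_from :: "'l \<Rightarrow> 'n"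
  line_to :: "'l \<Rightarrow> 'n"
  line_b :: "'l \<Rightarrow> real"
  load :: "real ^ 'n"
  cost_c :: "real ^ 'n"
  cost_q :: "real ^ 'n"
  g_min :: "real ^ 'n"
  g_max :: "real ^ 'n"
  theta_min :: "real ^ 'n"
  theta_max :: "real ^ 'n"
  r_min :: "real ^ 'n"
  r_max :: "real ^ 'n"
  f_min :: "real ^ 'l"
  f_max :: "real ^ 'l"
  big_M :: "real ^ 'l"
  max_open :: nat
  F_mat :: "real ^ 'k ^ 'n"
  eps :: "('n, 'l) cc_index \<Rightarrow> real"

record ('n::finite, 'l::finite, 'k::finite, 'w::finite) decision =
  gen :: "real ^ 'n"
  theta :: "real ^ 'n"
  flow :: "real ^ 'l"
  zz :: "real ^ 'l"
  gam :: "real ^ 'n"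
  Y_theta :: "real ^ 'k ^ 'n"
  Y_f :: "real ^ 'k ^ 'l"
  Phi1 :: "real ^ 'l ^ 'w"
  Phi2 :: "real ^ 'l ^ 'w"

definition A_mat :: "('n::finite, 'l::finite, 'k::finite, 'w::finite) ots_data \<Rightarrow> real ^ 'l ^ 'n" where
  "A_mat D = (\<chi> n l. (axis (line_from D l) 1 - axis (line_to D l) 1) $ n)"

definition K_mat :: "('n::finite, 'l::finite, 'k::finite, 'w::finite) ots_data \<Rightarrow> real ^ 'n ^ 'l" where
  "K_mat D = (\<chi> l. line_b D l *\<^sub>R (axis (line_from D l) 1 - axis (line_to D l) 1))"

text \<open>The rank-one matrix \<open>\<gamma> e\<^sup>T\<close>.\<close>

definition times_ones :: "real ^ 'n \<Rightarrow> real ^ 'k ^ 'n" where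
  "times_ones v = (\<chi> n k. v $ n)"

section \<open>Deterministic constraints\<close>

definition det_constraints ::
  "('n::finite, 'l::finite, 'k::finite, 'w::finite) ots_data \<Rightarrow> ('n, 'l, 'k, 'w) decision \<Rightarrow> bool" where
  "det_constraints D x \<longleftrightarrow>
     (\<forall>l. zz x $ l \<in> {0, 1}) \<and>
     0 \<le> gam x \<and> gam x \<le> 1 \<and>
     0 \<le> Phi1 x \<and> 0 \<le> Phi2 x \<and>
     1 \<bullet> gam x = 1 \<and>
     g_min D \<le> gen x \<and> gen x \<le> g_max D \<and>
     theta_min D \<le> theta x \<and> theta x \<le> theta_max D \<and>
     f_min D * zz x \<le> flow x \<and> flow x \<le> f_max D * zz x \<and>
     A_mat D *v flow x = gen x - load D \<and>
     K_mat D *v theta x - flow x + big_M D * (1 - zz x) \<ge> 0 \<and>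
     K_mat D *v theta x - flow x - big_M D * (1 - zz x) \<le> 0 \<and>
     1 \<bullet> zz x \<ge> real CARD('l) - real (max_open D) \<and>
     A_mat D ** Y_f x = times_ones (gam x) - F_mat D \<and>
     Y_f x = K_mat D ** Y_theta x + transpose (Phi1 x) ** U_mat D \<and>
     K_mat D *v theta x + big_M D * (1 - zz x) - transpose (Phi1 x) *v t_vec D \<ge> flow x \<and>
     Y_f x = K_mat D ** Y_theta x - transpose (Phi2 x) ** U_mat D \<and>
     big_M D * (1 - zz x) - transpose (Phi2 x) *v t_vec D + flow x \<ge> K_mat D *v theta x"

section \<open>Distributionally robust chance constraints\<close>

definition uncertainty_set :: "('n::finite, 'l::finite, 'k::finite, 'w::finite) ots_data \<Rightarrow> (real ^ 'k) set" where
  "uncertainty_set D = {\<xi>. U_mat D *v \<xi> \<le> t_vec D}"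

definition distributions_on :: "(real ^ 'k::finite) set \<Rightarrow> (real ^ 'k) measure set" where
  "distributions_on S = {P. prob_space P \<and> sets P = sets borel \<and> measure P S = 1}"

text \<open>
  The expectations below are vector-valued Bochner integrals.  They are used for compact
  supports only, where both integrands are bounded almost surely and hence integrable.
\<close>

definition ambiguity_set ::
  "('n::finite, 'l::finite, 'k::finite, 'w::finite) ots_data \<Rightarrow> (real ^ 'k) measure set" where
  "ambiguity_set D = {P \<in> distributions_on (uncertainty_set D).
     (\<integral>\<xi>. \<xi> \<partial>P) = mu_vec D \<and> (\<integral>\<xi>. \<bar>\<xi> - mu_vec D\<bar> \<partial>P) \<le> sigma_vec D}"

fun cc_a :: "('n::finite, 'l::finite, 'k::finite, 'w::finite) decision \<Rightarrow> ('n, 'l) cc_index \<Rightarrow> real ^ 'k" where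
  "cc_a x (R_lower n) = - (gam x $ n *\<^sub>R 1)"
| "cc_a x (R_upper n) = gam x $ n *\<^sub>R 1"
| "cc_a x (G_lower n) = - (gam x $ n *\<^sub>R 1)"
| "cc_a x (G_upper n) = gam x $ n *\<^sub>R 1"
| "cc_a x (Theta_lower n) = - (Y_theta x $ n)"
| "cc_a x (Theta_upper n) = Y_theta x $ n"
| "cc_a x (F_lower l) = - (Y_f x $ l)"
| "cc_a x (F_upper l) = Y_f x $ l"

fun cc_b :: "('n::finite, 'l::finite, 'k::finite, 'w::finite) ots_data \<Rightarrow>
  ('n, 'l, 'k, 'w) decision \<Rightarrow> ('n, 'l) cc_index \<Rightarrow> real" where
  "cc_b D x (R_lower n) = - (r_min D $ n)"
| "cc_b D x (R_upper n) = r_max D $ n"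
| "cc_b D x (G_lower n) = gen x $ n - g_min D $ n"
| "cc_b D x (G_upper n) = g_max D $ n - gen x $ n"
| "cc_b D x (Theta_lower n) = theta x $ n - theta_min D $ n"
| "cc_b D x (Theta_upper n) = theta_max D $ n - theta x $ n"
| "cc_b D x (F_lower l) = flow x $ l - f_min D $ l * zz x $ l"
| "cc_b D x (F_upper l) = f_max D $ l * zz x $ l - flow x $ l"

text \<open>The normal forms \<open>a\<^sub>i(x)\<^sup>T \<xi> \<le> b\<^sub>i(x)\<close> are exactly the original two-sided vector inequalities.\<close>

lemma all_cc_index:
  "(\<forall>i. Q i) \<longleftrightarrow>
     (\<forall>n. Q (R_lower n)) \<and> (\<forall>n. Q (R_upper n)) \<and> (\<forall>n. Q (G_lower n)) \<and> (\<forall>n. Q (G_upper n)) \<and>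
     (\<forall>n. Q (Theta_lower n)) \<and> (\<forall>n. Q (Theta_upper n)) \<and> (\<forall>l. Q (F_lower l)) \<and> (\<forall>l. Q (F_upper l))"
  by (metis cc_index.exhaust)

lemma times_ones_nth: "times_ones v $ n = v $ n *\<^sub>R 1"
  by (simp add: times_ones_def vec_eq_iff)

lemma cc_normal_form:
  "(\<forall>i. cc_a x i \<bullet> \<xi> \<le> cc_b D x i) \<longleftrightarrow>
     r_min D \<le> times_ones (gam x) *v \<xi> \<and> times_ones (gam x) *v \<xi> \<le> r_max D \<and>
     g_min D \<le> gen x + times_ones (gam x) *v \<xi> \<and> gen x + times_ones (gam x) *v \<xi> \<le> g_max D \<and>
     theta_min D \<le> theta x + Y_theta x *v \<xi> \<and> theta x + Y_theta x *v \<xi> \<le> theta_max D \<and>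
     f_min D * zz x \<le> flow x + Y_f x *v \<xi> \<and> flow x + Y_f x *v \<xi> \<le> f_max D * zz x"
  unfolding all_cc_index less_eq_vec_def
  by (simp add: times_ones_nth matrix_vector_mul_component algebra_simps)

definition dr_chance_constraint ::
  "('n::finite, 'l::finite, 'k::finite, 'w::finite) ots_data \<Rightarrow>
   ('n, 'l, 'k, 'w) decision \<Rightarrow> ('n, 'l) cc_index \<Rightarrow> bool" where
  "dr_chance_constraint D x i \<longleftrightarrow>
     (INF P\<in>ambiguity_set D. measure P {\<xi>. cc_a x i \<bullet> \<xi> \<le> cc_b D x i}) \<ge> 1 - eps D i"

section \<open>The two optimization problems\<close>

record 'a min_problem =
  feasible :: "'a set"
  objective :: "'a \<Rightarrow> real"

definition ots_objective ::
  "('n::finite, 'l::finite, 'k::finite, 'w::finite) ots_data \<Rightarrow> (real ^ 'k) measure \<Rightarrow>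
   ('n, 'l, 'k, 'w) decision \<Rightarrow> real" where
  "ots_objective D P x = cost_c D \<bullet> gen x + (\<integral>\<xi>. (cost_q D \<bullet> gam x) * (1 \<bullet> \<xi>) \<partial>P)"

lemma ots_objective_eq:
  fixes D :: "('n::finite, 'l::finite, 'k::finite, 'w::finite) ots_data"
  assumes "compact (uncertainty_set D)" and P: "P \<in> distributions_on (uncertainty_set D)" "(\<integral>\<xi>. \<xi> \<partial>P) = mu_vec D"
  shows "ots_objective D P x = cost_c D \<bullet> gen x + (cost_q D \<bullet> gam x) * (1 \<bullet> mu_vec D)"
proof -
  interpret prob_space P using P by (simp add: distributions_on_def)
  have [measurable_cong]: "sets P = sets borel" and 1: "prob (uncertainty_set D) = 1"
    using P by (simp_all add: distributions_on_def)
  obtain B where B: "\<And>\<xi>. \<xi> \<in> uncertainty_set D \<Longrightarrow> norm \<xi> \<le> B"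
    using assms(1) compact_imp_bounded bounded_iff by metis
  have "uncertainty_set D \<in> sets P"
    using assms(1) \<open>sets P = sets borel\<close> by (simp add: borel_compact)
  then have "AE \<xi> in P. \<xi> \<in> uncertainty_set D"
    using 1 AE_prob_1 by blast
  then have "integrable P (\<lambda>\<xi>. \<xi>)"
    by (intro integrable_const_bound[where B = B]) (auto elim!: eventually_mono dest: B)
  then show ?thesis
    using P(2) by (simp add: ots_objective_def)
qed

definition drcc_ots ::
  "('n::finite, 'l::finite, 'k::finite, 'w::finite) ots_data \<Rightarrow> (real ^ 'k) measure \<Rightarrow>
   ('n, 'l, 'k, 'w) decision min_problem" where
  "drcc_ots D P = \<lparr>
     feasible = {x. det_constraints D x \<and> (\<forall>i. dr_chance_constraint D x i)},
     objective = ots_objective D P\<rparr>"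

record ('k::finite, 'w::finite) aux_vars =
  alpha :: real
  beta :: "real ^ 'k"
  kappa :: "real ^ 'k"
  lam :: real
  pi1 :: "real ^ 'k"
  pi2 :: "real ^ 'k"
  tau1 :: "real ^ 'k"
  tau2 :: "real ^ 'k"
  psi1 :: "real ^ 'w"
  psi2 :: "real ^ 'w"

definition aux_constraints ::
  "('n::finite, 'l::finite, 'k::finite, 'w::finite) ots_data \<Rightarrow>
   ('n, 'l, 'k, 'w) decision \<Rightarrow> ('n, 'l) cc_index \<Rightarrow> ('k, 'w) aux_vars \<Rightarrow> bool" where
  "aux_constraints D x i y \<longleftrightarrow>
     0 \<le> kappa y \<and> 0 \<le> lam y \<and>
     0 \<le> pi1 y \<and> 0 \<le> pi2 y \<and> 0 \<le> tau1 y \<and> 0 \<le> tau2 y \<and> 0 \<le> psi1 y \<and> 0 \<le> psi2 y \<and>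
     alpha y + beta y \<bullet> mu_vec D - kappa y \<bullet> sigma_vec D \<ge> (1 - eps D i) * lam y \<and>
     alpha y + (pi1 y - tau1 y) \<bullet> mu_vec D + psi1 y \<bullet> t_vec D \<le> lam y \<and>
     beta y + tau1 y = pi1 y + psi1 y v* U_mat D \<and>
     pi1 y + tau1 y = kappa y \<and>
     alpha y + (pi2 y - tau2 y) \<bullet> mu_vec D + psi2 y \<bullet> t_vec D \<le> cc_b D x i \<and>
     beta y + cc_a x i + tau2 y = pi2 y + psi2 y v* U_mat D \<and>
     pi2 y + tau2 y = kappa y"

text \<open>The variables are the decision together with one block of auxiliary variables per index.\<close>

definition reformulation ::
  "('n::finite, 'l::finite, 'k::finite, 'w::finite) ots_data \<Rightarrow> (real ^ 'k) measure \<Rightarrow>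
   (('n, 'l, 'k, 'w) decision \<times> (('n, 'l) cc_index \<Rightarrow> ('k, 'w) aux_vars)) min_problem" where
  "reformulation D P = \<lparr>
     feasible = {(x, y). det_constraints D x \<and> (\<forall>i. aux_constraints D x i (y i))},
     objective = (\<lambda>(x, y). ots_objective D P x)\<rparr>"

end

theory Submission
  imports Defs
begin

text \<open>
  Fix one chance constraint \<open>a \<bullet> \<xi> \<le> d\<close> with level \<open>p = 1 - \<epsilon>\<close>.  The moment vectors
  \<open>(E[\<xi>] - \<mu>, E\<bar>\<xi> - \<mu>\<bar>, P(a \<bullet> \<xi> \<le> d))\<close> of the finitely supported distributions form the convex hull
  of the moment vectors of the points of the support.  If every distribution in the ambiguity set
  has probability at least \<open>p\<close>, this convex set can be separated from
  \<open>{0} \<times> {v. v \<le> \<sigma>} \<times> {..<p}\<close>; by Slater's condition the separating functional can be normalised, which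
  yields a concave function \<open>f \<xi> = c + b \<bullet> \<xi> - k \<bullet> \<bar>\<xi> - \<mu>\<bar>\<close> below the indicator of \<open>a \<bullet> \<xi> \<le> d\<close>
  on the support with \<open>c + b \<bullet> \<mu> - k \<bullet> \<sigma> \<ge> p\<close>.

  Unless the constraint holds on the whole support (where \<open>\<lambda> = 0\<close> and \<open>f = 0\<close> do), the implication
  \<open>a \<bullet> \<xi> > d \<Longrightarrow> f \<xi> \<le> 0\<close> has a multiplier \<open>r\<close> with \<open>f \<xi> \<le> r (d - a \<bullet> \<xi>)\<close>.  It is positive because
  \<open>f \<mu> > 0\<close>, and dividing by it produces the variable \<open>\<lambda> = 1 / r\<close>.  The two bounds
  \<open>f \<le> \<lambda>\<close> and \<open>f \<xi> \<le> d - a \<bullet> \<xi>\<close> over the polytope are linear programs once \<open>\<bar>\<xi> - \<mu>\<bar>\<close> is replaced by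
  its epigraph, and Farkas' lemma turns them into the dual variables \<open>\<pi>\<close>, \<open>\<tau>\<close> and \<open>\<psi>\<close>.
\<close>

section \<open>Linear programming duality over a polyhedron with absolute deviations\<close>

text \<open>The consequences of the system form a finitely generated, hence closed, convex cone of
  pairs \<open>(c, d)\<close>. A pair outside it can be strictly separated, and the separating
  vector yields either a feasible point that violates \<open>bound\<close> or a recession direction
  along which \<open>c\<close> grows without limit.\<close>

lemma affine_Farkas:
  fixes M :: "'j::finite \<Rightarrow> 'a::euclidean_space" and h :: "'j \<Rightarrow> real"
  assumes z0: "\<And>j. M j \<bullet> z0 \<le> h j"
    and bound: "\<And>z. (\<And>j. M j \<bullet> z \<le> h j) \<Longrightarrow> c \<bullet> z \<le> d"
  obtains y where "\<And>j. 0 \<le> y j" "c = (\<Sum>j\<in>UNIV. y j *\<^sub>R M j)" "(\<Sum>j\<in>UNIV. y j * h j) \<le> d"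
proof -
  define G where "G = insert (0, 1) (range (\<lambda>j. (M j, h j)))"
  define K where "K = {(\<Sum>j\<in>UNIV. y j *\<^sub>R M j, (\<Sum>j\<in>UNIV. y j * h j) + s) | y s. (\<forall>j. 0 \<le> y j) \<and> 0 \<le> s}"
  have cone_K: "convex_cone K"
    unfolding convex_cone_iff
  proof (intro conjI ballI allI impI)
    show "0 \<in> K"
      unfolding K_def by (auto intro!: exI[of _ "\<lambda>_. 0"] exI[of _ 0] simp: zero_prod_def)
  next
    fix p q assume "p \<in> K" "q \<in> K"
    then obtain y s y' s' where "\<forall>j. 0 \<le> y j" "0 \<le> s" "\<forall>j. 0 \<le> y' j" "0 \<le> s'"
      and "p = (\<Sum>j\<in>UNIV. y j *\<^sub>R M j, (\<Sum>j\<in>UNIV. y j * h j) + s)"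
      and "q = (\<Sum>j\<in>UNIV. y' j *\<^sub>R M j, (\<Sum>j\<in>UNIV. y' j * h j) + s')"
      unfolding K_def by blast
    then show "p + q \<in> K"
      unfolding K_def
      by (intro CollectI exI[of _ "\<lambda>j. y j + y' j"] exI[of _ "s + s'"])
        (simp add: sum.distrib algebra_simps)
  next
    fix p and r :: real assume "p \<in> K" "0 \<le> r"
    then obtain y s where "\<forall>j. 0 \<le> y j" "0 \<le> s"
      and "p = (\<Sum>j\<in>UNIV. y j *\<^sub>R M j, (\<Sum>j\<in>UNIV. y j * h j) + s)"
      unfolding K_def by blast
    with \<open>0 \<le> r\<close> show "r *\<^sub>R p \<in> K"
      unfolding K_def
      by (intro CollectI exI[of _ "\<lambda>j. r * y j"] exI[of _ "r * s"])
        (simp add: scaleR_right.sum sum_distrib_left algebra_simps)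
  qed
  have "G \<subseteq> K"
  proof -
    have "(0, 1) \<in> K"
      unfolding K_def by (auto intro!: exI[of _ "\<lambda>_. 0"] exI[of _ 1])
    moreover have "(M i, h i) \<in> K" for i
      unfolding K_def
      by (intro CollectI exI[of _ "\<lambda>j. if j = i then 1 else 0"] exI[of _ 0])
        (simp add: if_distrib[of "\<lambda>r. r *\<^sub>R _"] if_distrib[of "\<lambda>r. r * _"] cong: if_cong)
    ultimately show ?thesis
      unfolding G_def by blast
  qed
  then have hull_K: "convex_cone hull G \<subseteq> K"
    by (intro hull_minimal cone_K)
  have "(c, d) \<in> convex_cone hull G"
  proof (rule ccontr)
    assume "(c, d) \<notin> convex_cone hull G"
    moreover have "closed (convex_cone hull G)"
      unfolding G_def by (intro closed_convex_cone_hull) simp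
    ultimately obtain w e where w: "w \<bullet> (c, d) < e" "\<And>p. p \<in> convex_cone hull G \<Longrightarrow> e < w \<bullet> p"
      using separating_hyperplane_closed_point[OF convex_convex_cone_hull] by blast
    have "e < 0"
      using w(2)[OF convex_cone_hull_contains_0] by simp
    \<comment> \<open>A functional bounded below on a cone is nonnegative there: a point with
      negative value could be rescaled to have value exactly \<open>e\<close>, but all values exceed
      \<open>e\<close>.\<close>
    have w_nonneg: "0 \<le> w \<bullet> p" if "p \<in> convex_cone hull G" for p
    proof (rule ccontr)
      assume *: "\<not> 0 \<le> w \<bullet> p"
      then have "0 \<le> e / (w \<bullet> p)"
        using \<open>e < 0\<close> by (simp add: divide_nonpos_nonpos)
      from w(2)[OF convex_cone_hull_mul[OF that this]] * show False
        by simp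
    qed
    \<comment> \<open>With this sign, nonnegativity on the generators says that \<open>v\<close>
      satisfies the system with right-hand sides scaled by \<open>s\<close>.\<close>
    obtain v s where ws: "w = (- v, s)"
      by (metis minus_minus surj_pair)
    have "0 \<le> w \<bullet> (0, 1)" "\<And>j. 0 \<le> w \<bullet> (M j, h j)"
      by (rule w_nonneg, rule hull_inc, simp add: G_def)+
    then have s: "0 \<le> s" and M: "\<And>j. M j \<bullet> v \<le> s * h j"
      by (auto simp: ws inner_commute)
    have cd: "s * d < c \<bullet> v"
      using w(1) \<open>e < 0\<close> by (simp add: ws inner_commute[of v] mult.commute)
    show False
    proof (cases "s = 0")
      case False
      with s have "c \<bullet> ((1 / s) *\<^sub>R v) \<le> d"
        using M by (intro bound) (simp add: field_simps)
      with cd False s show False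
        by (simp add: field_simps)
    next
      \<comment> \<open>Now \<open>v\<close> is a recession direction with
        \<open>c \<bullet> v > 0\<close>, so moving from \<open>z0\<close> along it stays feasible
        and eventually exceeds \<open>d\<close>; the multiple chosen below overshoots by at least
        1.\<close>
      case True
      have "c \<bullet> (z0 + r *\<^sub>R v) \<le> d" if "0 \<le> r" for r
      proof (rule bound)
        fix j show "M j \<bullet> (z0 + r *\<^sub>R v) \<le> h j"
          using z0[of j] M[of j] True that
            mult_nonneg_nonpos[of r "M j \<bullet> v"] by (simp add: inner_right_distrib)
      qed
      from this[of "(\<bar>d - c \<bullet> z0\<bar> + 1) / (c \<bullet> v)"] cd True show False
        by (simp add: inner_right_distrib)
    qed
  qed
  with hull_K obtain y s where "\<forall>j. 0 \<le> y j" "0 \<le> s"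
      "(c, d) = (\<Sum>j\<in>UNIV. y j *\<^sub>R M j, (\<Sum>j\<in>UNIV. y j * h j) + s)"
    unfolding K_def by blast
  then show thesis
    by (intro that[of y]) auto
qed

lemma sum_UNIV_Plus:
  fixes g :: "'a::finite + 'b::finite \<Rightarrow> 'c::comm_monoid_add"
  shows "(\<Sum>j\<in>UNIV. g j) = (\<Sum>a\<in>UNIV. g (Inl a)) + (\<Sum>b\<in>UNIV. g (Inr b))"
  by (subst UNIV_Plus_UNIV[symmetric], subst sum.Plus) simp_all

lemma inner_vec_mono:
  fixes v w x :: "real ^ 'k"
  assumes "0 \<le> x" "v \<le> w"
  shows "x \<bullet> v \<le> x \<bullet> w"
  using assms by (auto simp: inner_vec_def less_eq_vec_def intro!: sum_mono mult_left_mono)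

text \<open>Pair the vector equation with \<open>\<xi>\<close>: the \<open>y\<close> part is bounded
  by \<open>y \<bullet> t\<close>, and \<open>(p - q) \<bullet> (\<xi> - m)\<close> is at most
  \<open>(p + q) \<bullet> \<bar>\<xi> - m\<bar>\<close>, which the \<open>k\<close> term
  cancels.\<close>

lemma abs_deviation_weak_dual:
  fixes U :: "real ^ 'k ^ 'w"
  assumes nonneg: "0 \<le> p" "0 \<le> q" "0 \<le> y"
    and obj: "c + (p - q) \<bullet> m + y \<bullet> t \<le> d"
    and eqs: "b + q = p + y v* U" "p + q = k"
    and \<xi>: "U *v \<xi> \<le> t"
  shows "c + b \<bullet> \<xi> - k \<bullet> \<bar>\<xi> - m\<bar> \<le> d"
proof -
  have "b \<bullet> \<xi> = (p - q) \<bullet> \<xi> + y \<bullet> (U *v \<xi>)"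
    using arg_cong[OF eqs(1), of "\<lambda>v. v \<bullet> \<xi>"]
    by (simp add: dot_lmul_matrix inner_left_distrib inner_diff_left)
  moreover have "y \<bullet> (U *v \<xi>) \<le> y \<bullet> t"
    by (rule inner_vec_mono[OF nonneg(3) \<xi>])
  moreover have "p \<bullet> (\<xi> - m) \<le> p \<bullet> \<bar>\<xi> - m\<bar>" "q \<bullet> (- (\<xi> - m)) \<le> q \<bullet> \<bar>\<xi> - m\<bar>"
    using nonneg by (auto intro!: inner_vec_mono simp: less_eq_vec_def abs_vec_def)
  ultimately show ?thesis
    using obj eqs(2)
    by (auto simp: inner_left_distrib inner_diff_left inner_diff_right)
qed

text \<open>The bound is linear in a pair \<open>(\<xi>, u)\<close> with
  \<open>\<bar>\<xi> - m\<bar> \<le> u\<close>, because \<open>k\<close> is nonnegative and larger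
  \<open>u\<close> only lowers the value. Farkas' lemma on this lifted polyhedron gives the
  multipliers.\<close>

lemma abs_deviation_dual:
  fixes U :: "real ^ 'k::finite ^ 'w::finite"
  assumes k: "0 \<le> k" and \<xi>0: "U *v \<xi>0 \<le> t"
    and bound: "\<And>\<xi>. U *v \<xi> \<le> t \<Longrightarrow> c + b \<bullet> \<xi> - k \<bullet> \<bar>\<xi> - m\<bar> \<le> d"
  obtains p q y where "0 \<le> p" "0 \<le> q" "0 \<le> y" "c + (p - q) \<bullet> m + y \<bullet> t \<le> d"
    "b + q = p + y v* U" "p + q = k"
proof -
  \<comment> \<open>The three blocks are \<open>\<xi> - u \<le> m\<close>,
    \<open>- \<xi> - u \<le> - m\<close> and \<open>U *v \<xi> \<le> t\<close>; their multipliers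
    become \<open>p\<close>, \<open>q\<close> and \<open>y\<close>.\<close>
  define M :: "'k + 'k + 'w \<Rightarrow> (real ^ 'k) \<times> (real ^ 'k)" where
    "M = (\<lambda>j. case j of Inl i \<Rightarrow> (axis i 1, - axis i 1)
      | Inr (Inl i) \<Rightarrow> (- axis i 1, - axis i 1) | Inr (Inr w) \<Rightarrow> (U $ w, 0))"
  define h where
    "h = (\<lambda>j. case j of Inl i \<Rightarrow> m $ i | Inr (Inl i) \<Rightarrow> - m $ i | Inr (Inr w) \<Rightarrow> t $ w)"
  have M_le: "(\<forall>j. M j \<bullet> (\<xi>, u) \<le> h j) \<longleftrightarrow> \<bar>\<xi> - m\<bar> \<le> u \<and> U *v \<xi> \<le> t" for \<xi> u
    unfolding M_def h_def less_eq_vec_def split_sum_all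
    by (auto simp: inner_axis' matrix_vector_mul_component abs_vec_def abs_diff_le_iff algebra_simps)
  have feasible: "M j \<bullet> (\<xi>0, \<bar>\<xi>0 - m\<bar>) \<le> h j" for j
    using M_le[of \<xi>0 "\<bar>\<xi>0 - m\<bar>"] \<xi>0 by simp
  have bounded: "(b, - k) \<bullet> z \<le> d - c" if "\<And>j. M j \<bullet> z \<le> h j" for z
  proof -
    obtain \<xi> u where z: "z = (\<xi>, u)"
      by (cases z)
    have "\<bar>\<xi> - m\<bar> \<le> u" "U *v \<xi> \<le> t"
      using that M_le unfolding z by auto
    with bound[of \<xi>] inner_vec_mono[OF k, of "\<bar>\<xi> - m\<bar>" u] show ?thesis
      by (simp add: z)
  qed
  obtain v where v: "\<And>j. 0 \<le> v j" "(b, - k) = (\<Sum>j\<in>UNIV. v j *\<^sub>R M j)"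
    "(\<Sum>j\<in>UNIV. v j * h j) \<le> d - c"
    using affine_Farkas[of M, OF feasible bounded] by blast
  define p q y where "p = (\<chi> i. v (Inl i))" and "q = (\<chi> i. v (Inr (Inl i)))"
    and "y = (\<chi> w. v (Inr (Inr w)))"
  have axis_sum: "(\<Sum>i\<in>UNIV. f i *\<^sub>R axis i 1) = (\<chi> i. f i)" for f :: "'k \<Rightarrow> real"
    by (simp add: vec_eq_iff axis_def if_distrib[of "\<lambda>r. _ * r"] cong: if_cong)
  have yU: "y v* U = (\<Sum>w\<in>UNIV. v (Inr (Inr w)) *\<^sub>R U $ w)"
    by (simp add: vec_eq_iff vector_matrix_mult_def y_def mult.commute)
  have "b = p - q + y v* U" "- k = - p - q"
    using v(2) axis_sum[of "\<lambda>i. v (Inl i)"] axis_sum[of "\<lambda>i. v (Inr (Inl i))"]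
    by (simp_all add: sum_UNIV_Plus M_def yU p_def q_def sum_negf sum_prod fst_sum snd_sum prod_eq_iff)
  moreover have "(p - q) \<bullet> m + y \<bullet> t \<le> d - c"
    using v(3) by (simp add: sum_UNIV_Plus h_def p_def q_def y_def inner_vec_def
      left_diff_distrib sum_subtractf sum_negf)
  ultimately show thesis
    using v(1) by (intro that[of p q y])
      (auto simp: p_def q_def y_def less_eq_vec_def algebra_simps)
qed

section \<open>Separation arguments and consequences of Slater's condition\<close>

text \<open>A theorem of the alternative: the joint hypograph of \<open>g\<close> and
  \<open>f\<close> is convex and misses the open positive quadrant. Separating the two gives
  nonnegative weights, and the point \<open>x0\<close> forces the weight of \<open>f\<close> to be
  positive, so it can be scaled to 1.\<close>

lemma concave_multiplier:
  fixes f g :: "'a::real_vector \<Rightarrow> real"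
  assumes f: "concave_on S f" and g: "concave_on S g"
    and slater: "x0 \<in> S" "0 < g x0"
    and implied: "\<And>x. x \<in> S \<Longrightarrow> 0 < g x \<Longrightarrow> f x \<le> 0"
  obtains r where "0 \<le> r" "\<And>x. x \<in> S \<Longrightarrow> f x + r * g x \<le> 0"
proof -
  define C where "C = {(u, v). \<exists>x\<in>S. u \<le> g x \<and> v \<le> f x}"
  have "convex C"
    unfolding convex_alt
  proof (intro ballI allI impI)
    fix p q and r :: real assume "p \<in> C" "q \<in> C" and r: "0 \<le> r \<and> r \<le> 1"
    then obtain u v x u' v' x' where pq: "p = (u, v)" "q = (u', v')" and x: "x \<in> S" "x' \<in> S"
      and le: "u \<le> g x" "v \<le> f x" "u' \<le> g x'" "v' \<le> f x'"
      unfolding C_def by blast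
    have "(1 - r) * u + r * u' \<le> (1 - r) * g x + r * g x'"
      "(1 - r) * v + r * v' \<le> (1 - r) * f x + r * f x'"
      using le r by (auto intro!: add_mono mult_left_mono)
    moreover have "(1 - r) * g x + r * g x' \<le> g ((1 - r) *\<^sub>R x + r *\<^sub>R x')"
      "(1 - r) * f x + r * f x' \<le> f ((1 - r) *\<^sub>R x + r *\<^sub>R x')"
      using f g x r by (auto intro: concave_onD)
    moreover have "(1 - r) *\<^sub>R x + r *\<^sub>R x' \<in> S"
      using concave_on_imp_convex[OF f] x r unfolding convex_alt by auto
    ultimately show "(1 - r) *\<^sub>R p + r *\<^sub>R q \<in> C"
      unfolding C_def pq by (fastforce intro: bexI[of _ "(1 - r) *\<^sub>R x + r *\<^sub>R x'"])
  qed
  moreover have "convex ({0<..} \<times> {0<..} :: (real \<times> real) set)"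
    by (intro convex_Times convex_real_interval)
  moreover have "(g x0, f x0) \<in> C"
    using slater(1) unfolding C_def by blast
  moreover have "(1, 1) \<in> ({0<..} \<times> {0<..} :: (real \<times> real) set)"
    by simp
  moreover have "C \<inter> ({0<..} \<times> {0<..}) = {}"
  proof -
    have False if "x \<in> S" "0 < u" "u \<le> g x" "0 < v" "v \<le> f x" for x u v
      using implied[OF that(1)] that by linarith
    then show ?thesis
      unfolding C_def by auto
  qed
  ultimately obtain w e where w: "w \<noteq> 0" "\<And>z. z \<in> C \<Longrightarrow> w \<bullet> z \<le> e"
    "\<And>z. z \<in> {0<..} \<times> {0<..} \<Longrightarrow> e \<le> w \<bullet> z"
    using separating_hyperplane_sets[of C "{0<..} \<times> {0<..}"] by blast
  obtain r s where rs: "w = (r, s)"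
    by fastforce
  have upper: "e \<le> r * u + s * v" if "0 < u" "0 < v" for u v
    using w(3)[of "(u, v)"] that by (simp add: rs)
  have "0 \<le> r"
  proof (rule ccontr)
    assume "\<not> 0 \<le> r"
    \<comment> \<open>This first coordinate is so large that the functional drops below
      \<open>e\<close> on the quadrant; the argument for \<open>s\<close> is symmetric.\<close>
    then have "0 < (\<bar>e - s\<bar> + 1) / (- r)" "r * ((\<bar>e - s\<bar> + 1) / (- r)) = - (\<bar>e - s\<bar> + 1)"
      by (auto simp: divide_pos_neg)
    with upper[of "(\<bar>e - s\<bar> + 1) / (- r)" 1] show False
      by auto
  qed
  have "0 \<le> s"
  proof (rule ccontr)
    assume "\<not> 0 \<le> s"
    then have "0 < (\<bar>e - r\<bar> + 1) / (- s)" "s * ((\<bar>e - r\<bar> + 1) / (- s)) = - (\<bar>e - r\<bar> + 1)"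
      by (auto simp: divide_pos_neg)
    with upper[of 1 "(\<bar>e - r\<bar> + 1) / (- s)"] show False
      by auto
  qed
  \<comment> \<open>The quadrant contains points arbitrarily close to the origin.\<close>
  have "e \<le> 0"
  proof (rule field_le_epsilon)
    fix d :: real assume "0 < d"
    define q where "q = d / (r + s + 1)"
    have q: "0 < q" "(r + s + 1) * q = d"
      using \<open>0 < d\<close> \<open>0 \<le> r\<close> \<open>0 \<le> s\<close> by (auto simp: q_def)
    then have "e \<le> r * q + s * q"
      by (intro upper)
    also have "\<dots> \<le> d"
      using q by (simp add: algebra_simps)
    finally show "e \<le> 0 + d"
      by simp
  qed
  have le0: "r * g x + s * f x \<le> 0" if "x \<in> S" for x
    using w(2)[of "(g x, f x)"] that \<open>e \<le> 0\<close> by (force simp: rs C_def)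
  have "0 < s"
  proof (rule ccontr)
    assume "\<not> 0 < s"
    with \<open>0 \<le> s\<close> \<open>0 \<le> r\<close> w(1) have "s = 0" "0 < r"
      by (auto simp: rs zero_prod_def)
    with le0[OF slater(1)] slater(2) show False
      by (simp add: mult_le_0_iff)
  qed
  show thesis
  proof (rule that)
    show "0 \<le> r / s"
      using \<open>0 \<le> r\<close> \<open>0 < s\<close> by simp
    show "f x + r / s * g x \<le> 0" if "x \<in> S" for x
      using le0[OF that] \<open>0 < s\<close> by (simp add: field_simps)
  qed
qed

lemma concave_on_abs_deviation:
  fixes b k m :: "real ^ 'k"
  assumes "convex S" "0 \<le> k"
  shows "concave_on S (\<lambda>\<xi>. c + b \<bullet> \<xi> - k \<bullet> \<bar>\<xi> - m\<bar>)"
  unfolding concave_on_iff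
proof (intro conjI ballI allI impI)
  fix x y and u v :: real
  assume uv: "0 \<le> u" "0 \<le> v" "u + v = 1"
  have "\<bar>u *\<^sub>R x + v *\<^sub>R y - m\<bar> \<le> u *\<^sub>R \<bar>x - m\<bar> + v *\<^sub>R \<bar>y - m\<bar>"
    unfolding less_eq_vec_def
  proof
    fix i
    have "u * x $ i + v * y $ i - m $ i = u * (x $ i - m $ i) + v * (y $ i - m $ i)"
      using uv(3) by (simp add: algebra_simps flip: distrib_left distrib_right)
    also have "\<bar>\<dots>\<bar> \<le> u * \<bar>x $ i - m $ i\<bar> + v * \<bar>y $ i - m $ i\<bar>"
      using uv by (metis abs_mult abs_of_nonneg abs_triangle_ineq)
    finally show "\<bar>u *\<^sub>R x + v *\<^sub>R y - m\<bar> $ i \<le> (u *\<^sub>R \<bar>x - m\<bar> + v *\<^sub>R \<bar>y - m\<bar>) $ i"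
      by (simp add: abs_vec_def)
  qed
  from inner_vec_mono[OF assms(2) this]
  have "k \<bullet> \<bar>u *\<^sub>R x + v *\<^sub>R y - m\<bar> \<le> u * (k \<bullet> \<bar>x - m\<bar>) + v * (k \<bullet> \<bar>y - m\<bar>)"
    by (simp add: inner_right_distrib)
  moreover have "c = u * c + v * c"
    using uv(3) by (simp flip: distrib_right)
  ultimately show "u * (c + b \<bullet> x - k \<bullet> \<bar>x - m\<bar>) + v * (c + b \<bullet> y - k \<bullet> \<bar>y - m\<bar>)
      \<le> c + b \<bullet> (u *\<^sub>R x + v *\<^sub>R y) - k \<bullet> \<bar>u *\<^sub>R x + v *\<^sub>R y - m\<bar>"
    by (simp add: inner_right_distrib algebra_simps)
qed (fact assms(1))

lemma interior_normal_zero: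
  fixes b m :: "'a::real_inner"
  assumes "m \<in> interior S" and nonpos: "\<And>x. x \<in> S \<Longrightarrow> b \<bullet> (x - m) \<le> 0"
  shows "b = 0"
proof (rule ccontr)
  assume "b \<noteq> 0"
  obtain e where e: "0 < e" "cball m e \<subseteq> S"
    using assms(1) by (auto simp: mem_interior_cball)
  \<comment> \<open>A step of length \<open>e\<close> in direction \<open>b\<close> stays in the
    ball but has positive inner product with \<open>b\<close>.\<close>
  have "m + (e / norm b) *\<^sub>R b \<in> cball m e"
    using e(1) \<open>b \<noteq> 0\<close> by (simp add: dist_norm)
  then have "b \<bullet> ((e / norm b) *\<^sub>R b) \<le> 0"
    using nonpos e(2) by force
  moreover have "0 < b \<bullet> b"
    using \<open>b \<noteq> 0\<close> by simp
  ultimately show False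
    using e(1) \<open>b \<noteq> 0\<close> by (simp add: divide_le_0_iff mult_le_0_iff)
qed

text \<open>The bound \<open>0\<close> corresponds to a vanishing multiplier of the probability.\<close>

lemma slater_multipliers_zero:
  fixes b k m s :: "real ^ 'k"
  assumes m: "m \<in> interior S" and s: "\<And>i. 0 < s $ i" and k: "0 \<le> k"
    and nonpos: "\<And>\<xi>. \<xi> \<in> S \<Longrightarrow> c + b \<bullet> \<xi> - k \<bullet> \<bar>\<xi> - m\<bar> \<le> 0"
    and nonneg: "0 \<le> c + b \<bullet> m - k \<bullet> s"
  shows "c = 0" "b = 0" "k = 0"
proof -
  have "\<bar>0 :: real ^ 'k\<bar> = 0"
    by (simp add: abs_vec_def vec_eq_iff)
  \<comment> \<open>The deviation vanishes at \<open>m\<close>. Together with \<open>nonneg\<close>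
    this squeezes both \<open>c + b \<bullet> m\<close> and \<open>k \<bullet> s\<close> to
    zero.\<close>
  then have at_m: "c + b \<bullet> m \<le> 0"
    using nonpos[of m] m interior_subset[of S] by auto
  have terms: "0 \<le> k $ i * s $ i" for i
    using k s[of i] by (simp add: less_eq_vec_def)
  then have "0 \<le> k \<bullet> s"
    unfolding inner_vec_def by (simp add: sum_nonneg)
  with at_m nonneg have sum0: "c + b \<bullet> m = 0" "k \<bullet> s = 0"
    by linarith+
  from sum0(2) terms have "\<forall>i. k $ i * s $ i = 0"
    by (simp add: inner_vec_def sum_nonneg_eq_0_iff)
  with s show "k = 0"
    by (metis less_irrefl mult_eq_0_iff vec_eq_iff zero_index)
  then show "b = 0"
    using nonpos sum0(1) by (intro interior_normal_zero[OF m]) (force simp: inner_diff_right)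
  with sum0(1) show "c = 0"
    by simp
qed

section \<open>Duality for the moment problem\<close>

lemma continuous_on_abs_deviation:
  fixes m :: "real ^ 'k"
  shows "continuous_on A (\<lambda>\<xi>. \<bar>\<xi> - m\<bar>)"
  unfolding abs_vec_def by (intro continuous_intros)

text \<open>The weights form a probability mass function on the indices, which is pushed forward
  along \<open>x\<close>; masses of coinciding points then add up by themselves.\<close>

lemma convex_combination_distribution:
  fixes S :: "(real ^ 'k) set"
  assumes S: "S \<in> sets borel" and I: "finite I"
    and u: "\<And>i. i \<in> I \<Longrightarrow> 0 \<le> u i" "sum u I = 1" and x: "\<And>i. i \<in> I \<Longrightarrow> x i \<in> S"
  obtains P where "P \<in> distributions_on S"
    "\<And>f :: real ^ 'k \<Rightarrow> real ^ 'k. f \<in> borel_measurable borel \<Longrightarrow>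
      (\<integral>\<xi>. f \<xi> \<partial>P) = (\<Sum>i\<in>I. u i *\<^sub>R f (x i))"
    "\<And>E. E \<in> sets borel \<Longrightarrow> measure P E = (\<Sum>i\<in>I. u i * indicator E (x i))"
proof -
  define w where "w i = (if i \<in> I then u i else 0)" for i
  have w_nonneg: "0 \<le> w i" for i
    using u(1) by (simp add: w_def)
  have "(\<integral>\<^sup>+i. ennreal (w i) \<partial>count_space UNIV) = (\<Sum>i\<in>I. ennreal (w i))"
    using I by (intro nn_integral_count_space') (auto simp: w_def)
  also have "\<dots> = 1"
    using u by (subst sum_ennreal) (auto simp: w_def)
  finally have w_total: "(\<integral>\<^sup>+i. ennreal (w i) \<partial>count_space UNIV) = 1" .
  define q where "q = embed_pmf w"
  have pmf_q: "pmf q i = w i" for i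
    unfolding q_def by (rule pmf_embed_pmf[OF w_nonneg w_total])
  have set_q: "i \<in> I" if "i \<in> set_pmf q" for i
    using that
    by (auto simp: set_pmf_eq pmf_q w_def split: if_splits)
  have integral_q: "(\<integral>i. f i \<partial>measure_pmf q) = (\<Sum>i\<in>I. u i *\<^sub>R f i)"
    for f :: "_ \<Rightarrow> 'c::{banach, second_countable_topology}"
    using set_q by (subst integral_measure_pmf[OF I]) (auto simp: pmf_q w_def)
  define P where "P = distr (measure_pmf q) borel x"
  have P: "prob_space P" "sets P = sets borel"
    unfolding P_def by (auto intro: measure_pmf.prob_space_distr)
  have measure_P: "measure P E = (\<Sum>i\<in>I. u i * indicator E (x i))" if "E \<in> sets borel" for E
  proof -
    have "measure P E = measure q (x -` E)"
      unfolding P_def using that by (simp add: measure_distr)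
    also have "\<dots> = (\<integral>i. indicator (x -` E) i \<partial>measure_pmf q)"
      by simp
    also have "\<dots> = (\<Sum>i\<in>I. u i *\<^sub>R indicator (x -` E) i)"
      by (rule integral_q)
    finally show ?thesis
      by (simp add: indicator_def)
  qed
  have "P \<in> distributions_on S"
    using P measure_P[OF S] u(2) x by (simp add: distributions_on_def)
  moreover have "(\<integral>\<xi>. f \<xi> \<partial>P) = (\<Sum>i\<in>I. u i *\<^sub>R f (x i))"
    if "f \<in> borel_measurable borel" for f :: "real ^ 'k \<Rightarrow> real ^ 'k"
    unfolding P_def using that by (simp add: integral_distr integral_q)
  ultimately show thesis
    using measure_P that by blast
qed

text \<open>Strong duality. Only finitely supported distributions enter, since a point of the convex
  hull of \<open>moments\<close> is a finite mixture; one lying in \<open>T\<close> would be a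
  distribution that violates \<open>robust\<close>.\<close>

lemma moment_duality:
  fixes S E :: "(real ^ 'k) set"
  assumes S: "S \<in> sets borel" and E: "E \<in> sets borel"
    and m: "m \<in> interior S" and s: "\<And>i. 0 < s $ i"
    and robust: "\<And>P. P \<in> distributions_on S \<Longrightarrow> (\<integral>\<xi>. \<xi> \<partial>P) = m \<Longrightarrow>
      (\<integral>\<xi>. \<bar>\<xi> - m\<bar> \<partial>P) \<le> s \<Longrightarrow> p \<le> measure P E"
  obtains c b k where "0 \<le> k" "\<And>\<xi>. \<xi> \<in> S \<Longrightarrow> c + b \<bullet> \<xi> - k \<bullet> \<bar>\<xi> - m\<bar> \<le> indicator E \<xi>"
    "p \<le> c + b \<bullet> m - k \<bullet> s"
proof -
  define moments where "moments \<xi> = (\<xi> - m, \<bar>\<xi> - m\<bar>, indicator E \<xi> :: real)" for \<xi>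
  define T where "T = {0 :: real ^ 'k} \<times> {v. v \<le> s} \<times> {..<p}"
  have mS: "m \<in> S"
    using m interior_subset by blast
  have "convex {v. v \<le> s}"
    unfolding convex_alt by (auto simp: less_eq_vec_def intro!: convex_bound_le)
  then have "convex T"
    unfolding T_def by (intro convex_Times convex_real_interval) auto
  moreover have "T \<noteq> {}"
    using order_refl[of s] lt_ex[of p] unfolding T_def by blast
  moreover have "convex hull (moments ` S) \<noteq> {}"
    using mS by auto
  moreover have "convex hull (moments ` S) \<inter> T = {}"
  proof (rule ccontr)
    assume "convex hull (moments ` S) \<inter> T \<noteq> {}"
    then obtain z where z: "z \<in> convex hull (moments ` S)" "z \<in> T"
      by blast
    then obtain n :: nat and u y where u: "\<forall>i\<in>{1..n}. 0 \<le> u i \<and> y i \<in> moments ` S"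
      "sum u {1..n} = 1" and z_eq: "(\<Sum>i = 1..n. u i *\<^sub>R y i) = z"
      unfolding convex_hull_indexed by blast
    from u(1) have "\<forall>i\<in>{1..n}. \<exists>\<xi>. \<xi> \<in> S \<and> y i = moments \<xi>"
      by blast
    from bchoice[OF this] obtain x where x: "\<And>i. i \<in> {1..n} \<Longrightarrow> x i \<in> S \<and> y i = moments (x i)"
      by blast
    obtain P where P: "P \<in> distributions_on S"
      and integral_P: "\<And>f :: real ^ 'k \<Rightarrow> real ^ 'k. f \<in> borel_measurable borel \<Longrightarrow>
        (\<integral>\<xi>. f \<xi> \<partial>P) = (\<Sum>i = 1..n. u i *\<^sub>R f (x i))"
      and measure_P: "\<And>E. E \<in> sets borel \<Longrightarrow> measure P E = (\<Sum>i = 1..n. u i * indicator E (x i))"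
      using convex_combination_distribution[OF S, of "{1..n}" u x] u x by auto
    have z_moments: "z = (\<Sum>i = 1..n. u i *\<^sub>R moments (x i))"
      using x by (auto simp flip: z_eq)
    have "(\<Sum>i = 1..n. u i *\<^sub>R (x i - m)) = 0" "(\<Sum>i = 1..n. u i *\<^sub>R \<bar>x i - m\<bar>) \<le> s"
      "(\<Sum>i = 1..n. u i * indicator E (x i)) < p"
      using z(2) unfolding z_moments moments_def T_def
      by (auto simp: sum_prod fst_sum snd_sum mem_Times_iff)
    moreover have "(\<lambda>\<xi>. \<bar>\<xi> - m\<bar>) \<in> borel_measurable borel"
      by (intro borel_measurable_continuous_onI continuous_on_abs_deviation)
    ultimately have "(\<integral>\<xi>. \<xi> \<partial>P) = m" "(\<integral>\<xi>. \<bar>\<xi> - m\<bar> \<partial>P) \<le> s" "measure P E < p"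
      using integral_P[of "\<lambda>\<xi>. \<xi>"] integral_P[of "\<lambda>\<xi>. \<bar>\<xi> - m\<bar>"] measure_P[OF E] u(2)
      by (simp_all add: scaleR_right_diff_distrib sum_subtractf flip: scaleR_left.sum)
    with robust[OF P] show False
      by simp
  qed
  ultimately have "\<exists>w e. w \<noteq> 0 \<and> (\<forall>z\<in>convex hull (moments ` S). w \<bullet> z \<le> e) \<and> (\<forall>z\<in>T. e \<le> w \<bullet> z)"
    by (intro separating_hyperplane_sets convex_convex_hull)
  then obtain w e where w: "w \<noteq> 0" "\<And>z. z \<in> convex hull (moments ` S) \<Longrightarrow> w \<bullet> z \<le> e"
    "\<And>z. z \<in> T \<Longrightarrow> e \<le> w \<bullet> z"
    by metis
  \<comment> \<open>The signs anticipate that \<open>k\<close> and \<open>r\<close> are nonnegative,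
    because \<open>T\<close> is unbounded below in its last two components.\<close>
  obtain b k r where w_eq: "w = (b, - k, - r)"
    using that[of "fst w" "- fst (snd w)" "- snd (snd w)"] by simp
  have lower: "b \<bullet> (\<xi> - m) - k \<bullet> \<bar>\<xi> - m\<bar> \<le> e + r * indicator E \<xi>" if "\<xi> \<in> S" for \<xi>
    using w(2)[OF hull_inc[OF imageI[OF that]]] by (simp add: w_eq moments_def)
  have upper: "e \<le> - (k \<bullet> v) - r * q" if "v \<le> s" "q < p" for v q
    using w(3)[of "(0, v, q)"] that by (simp add: w_eq T_def)
  have k: "0 \<le> k"
    unfolding less_eq_vec_def
  proof (intro allI, rule ccontr)
    fix i
    assume neg: "\<not> 0 $ i \<le> k $ i"
    \<comment> \<open>Lowering the i-th component of \<open>s\<close> by this amount pushes the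
      functional below \<open>e\<close>; the same device is used for \<open>r\<close>.\<close>
    define d where "d = (\<bar>- (k \<bullet> s) - r * (p - 1) - e\<bar> + 1) / (- k $ i)"
    have d: "0 < d" "d * k $ i = - (\<bar>- (k \<bullet> s) - r * (p - 1) - e\<bar> + 1)"
      using neg by (auto simp: d_def divide_pos_neg)
    have "s - d *\<^sub>R axis i 1 \<le> s"
      using d by (simp add: less_eq_vec_def axis_def)
    from upper[OF this, of "p - 1"] d show False
      by (simp add: inner_diff_right inner_axis)
  qed
  have r: "0 \<le> r"
  proof (rule ccontr)
    assume neg: "\<not> 0 \<le> r"
    define d where "d = (\<bar>- (k \<bullet> s) - r * p - e\<bar> + 1) / (- r)"
    have "0 < d" "d * r = - (\<bar>- (k \<bullet> s) - r * p - e\<bar> + 1)"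
      using neg by (auto simp: d_def divide_pos_neg)
    with upper[of s "p - d"] show False
      by (simp add: right_diff_distrib mult.commute)
  qed
  \<comment> \<open>This is the limit of \<open>upper\<close> at \<open>v = s\<close> as
    \<open>q\<close> tends to \<open>p\<close>. The denominator \<open>r + 1\<close> stays positive
    even for \<open>r = 0\<close>.\<close>
  have value_le: "r * p \<le> - e - k \<bullet> s"
  proof (rule field_le_epsilon)
    fix d :: real assume "0 < d"
    then have "r * (p - d / (r + 1)) \<le> - e - k \<bullet> s"
      using upper[of s "p - d / (r + 1)"] r by simp
    moreover have "r * (d / (r + 1)) \<le> d"
      using \<open>0 < d\<close> r by (simp add: field_simps)
    ultimately show "r * p \<le> - e - k \<bullet> s + d"
      by (simp add: right_diff_distrib)
  qed
  \<comment> \<open>With \<open>r = 0\<close>, Slater's condition would make \<open>b\<close> and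
    \<open>k\<close> vanish too, and hence \<open>w\<close>.\<close>
  have "r \<noteq> 0"
  proof
    assume "r = 0"
    have "- e - b \<bullet> m + b \<bullet> \<xi> - k \<bullet> \<bar>\<xi> - m\<bar> \<le> 0" if "\<xi> \<in> S" for \<xi>
      using lower[OF that] \<open>r = 0\<close> by (simp add: inner_diff_right)
    moreover have "0 \<le> - e - b \<bullet> m + b \<bullet> m - k \<bullet> s"
      using value_le \<open>r = 0\<close> by simp
    ultimately have "k = 0" "b = 0"
      using slater_multipliers_zero[OF m s k] by blast+
    with \<open>r = 0\<close> w(1) show False
      by (simp add: w_eq zero_prod_def)
  qed
  with r have "0 < r"
    by simp
  show thesis
  proof (rule that)
    show "0 \<le> (1 / r) *\<^sub>R k"
      using k r by (simp add: less_eq_vec_def)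
    show "(- e - b \<bullet> m) / r + ((1 / r) *\<^sub>R b) \<bullet> \<xi> - ((1 / r) *\<^sub>R k) \<bullet> \<bar>\<xi> - m\<bar> \<le> indicator E \<xi>"
      if "\<xi> \<in> S" for \<xi>
    proof -
      have "(- e + (b \<bullet> (\<xi> - m) - k \<bullet> \<bar>\<xi> - m\<bar>)) / r \<le> indicator E \<xi>"
        using lower[OF that] \<open>0 < r\<close> by (simp add: pos_divide_le_eq mult.commute)
      then show ?thesis
        by (simp add: inner_diff_right add_divide_distrib diff_divide_distrib)
    qed
    show "p \<le> (- e - b \<bullet> m) / r + ((1 / r) *\<^sub>R b) \<bullet> m - ((1 / r) *\<^sub>R k) \<bullet> s"
      using value_le \<open>0 < r\<close> by (simp add: field_simps)
  qed
qed

lemma distributions_onD: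
  assumes "P \<in> distributions_on S"
  shows "prob_space P" "sets P = sets borel" "measure P S = 1"
  using assms by (simp_all add: distributions_on_def)

lemma AE_distributions_on:
  assumes P: "P \<in> distributions_on S" and "S \<in> sets borel"
  shows "AE \<xi> in P. \<xi> \<in> S"
proof -
  interpret prob_space P
    using P by (rule distributions_onD)
  show ?thesis
    using assms AE_prob_1 distributions_onD by metis
qed

lemma integrable_distributions_on:
  fixes f :: "real ^ 'k \<Rightarrow> 'b::{banach, second_countable_topology}"
  assumes P: "P \<in> distributions_on S" and S: "compact S" and f: "continuous_on UNIV f"
  shows "integrable P f"
proof -
  interpret prob_space P
    using P by (rule distributions_onD)
  have [measurable_cong]: "sets P = sets borel"
    using P by (rule distributions_onD)
  have "compact (f ` S)"
    using f S by (intro compact_continuous_image) (auto intro: continuous_on_subset)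
  then obtain B where B: "\<And>\<xi>. \<xi> \<in> S \<Longrightarrow> norm (f \<xi>) \<le> B"
    using compact_imp_bounded bounded_iff by (metis imageI)
  have "f \<in> borel_measurable P"
    using borel_measurable_continuous_onI[OF f] by measurable
  moreover have "AE \<xi> in P. norm (f \<xi>) \<le> B"
    using AE_distributions_on[OF P borel_compact[OF S]] by eventually_elim (rule B)
  ultimately show ?thesis
    by (rule integrable_const_bound[rotated])
qed

text \<open>Integrate \<open>bound\<close>, which holds almost surely. The factor \<open>l\<close>
  may be zero, so it is not normalised away.\<close>

lemma moment_weak_duality:
  fixes S E :: "(real ^ 'k) set"
  assumes S: "compact S" and E: "E \<in> sets borel"
    and P: "P \<in> distributions_on S" "(\<integral>\<xi>. \<xi> \<partial>P) = m" "(\<integral>\<xi>. \<bar>\<xi> - m\<bar> \<partial>P) \<le> s"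
    and k: "0 \<le> k" and bound: "\<And>\<xi>. \<xi> \<in> S \<Longrightarrow> c + b \<bullet> \<xi> - k \<bullet> \<bar>\<xi> - m\<bar> \<le> l * indicator E \<xi>"
  shows "c + b \<bullet> m - k \<bullet> s \<le> l * measure P E"
proof -
  interpret prob_space P
    using P(1) by (rule distributions_onD)
  have E_P: "E \<in> sets P" and S_P: "S \<in> sets borel"
    using E distributions_onD(2)[OF P(1)] borel_compact[OF S] by auto
  have int [simp]: "integrable P (\<lambda>\<xi>. \<xi>)" "integrable P (\<lambda>\<xi>. \<bar>\<xi> - m\<bar>)"
    by (intro integrable_distributions_on[OF P(1) S] continuous_on_id continuous_on_abs_deviation)+
  have "c + b \<bullet> m - k \<bullet> s \<le> c + b \<bullet> (\<integral>\<xi>. \<xi> \<partial>P) - k \<bullet> (\<integral>\<xi>. \<bar>\<xi> - m\<bar> \<partial>P)"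
    using inner_vec_mono[OF k P(3)] P(2) by simp
  also have "\<dots> = (\<integral>\<xi>. c + b \<bullet> \<xi> - k \<bullet> \<bar>\<xi> - m\<bar> \<partial>P)"
    by (simp add: prob_space)
  also have "\<dots> \<le> (\<integral>\<xi>. l * indicator E \<xi> \<partial>P)"
    using AE_distributions_on[OF P(1) S_P] E_P
    by (intro integral_mono_AE) (auto elim!: eventually_mono intro: bound simp: less_top[symmetric])
  also have "\<dots> = l * measure P E"
    using E_P by simp
  finally show ?thesis .
qed

section \<open>A single robust chance constraint\<close>

text \<open>For the converse direction, the second bound is negative wherever
  \<open>a \<bullet> \<xi> > d\<close>, so both bounds together dominate the concave function by
  \<open>l\<close> times the indicator, and weak duality applies.\<close>

lemma robust_chance_iff_concave_bound:
  fixes S :: "(real ^ 'k) set"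
  assumes S: "compact S" "convex S" and m: "m \<in> interior S" and s: "\<And>i. 0 < s $ i"
    and p: "0 < p" "p \<le> 1"
  shows "(\<forall>P \<in> distributions_on S. (\<integral>\<xi>. \<xi> \<partial>P) = m \<longrightarrow> (\<integral>\<xi>. \<bar>\<xi> - m\<bar> \<partial>P) \<le> s \<longrightarrow>
      p \<le> measure P {\<xi>. a \<bullet> \<xi> \<le> d}) \<longleftrightarrow>
    (\<exists>c b k l. 0 \<le> k \<and> 0 \<le> l \<and> p * l \<le> c + b \<bullet> m - k \<bullet> s \<and>
      (\<forall>\<xi>\<in>S. c + b \<bullet> \<xi> - k \<bullet> \<bar>\<xi> - m\<bar> \<le> l) \<and>
      (\<forall>\<xi>\<in>S. c + b \<bullet> \<xi> - k \<bullet> \<bar>\<xi> - m\<bar> \<le> d - a \<bullet> \<xi>))"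
    (is "?robust \<longleftrightarrow> ?dual")
proof -
  define E where "E = {\<xi>. a \<bullet> \<xi> \<le> d}"
  have E: "E \<in> sets borel"
    unfolding E_def by (intro borel_closed closed_halfspace_le)
  have S_borel: "S \<in> sets borel" and mS: "m \<in> S"
    using S(1) m interior_subset by (auto intro: borel_compact)
  have abs0: "\<bar>0 :: real ^ 'k\<bar> = 0"
    by (simp add: abs_vec_def vec_eq_iff)
  show ?thesis
  proof
    assume ?robust
    show ?dual
    proof (cases "S \<subseteq> E")
      case True
      then show ?thesis
        by (intro exI[of _ 0]) (auto simp: E_def)
    next
      case False
      then obtain \<xi>0 where \<xi>0: "\<xi>0 \<in> S" "0 < a \<bullet> \<xi>0 - d"
        by (force simp: E_def)
      obtain c b k where k: "0 \<le> k"
        and le: "\<And>\<xi>. \<xi> \<in> S \<Longrightarrow> c + b \<bullet> \<xi> - k \<bullet> \<bar>\<xi> - m\<bar> \<le> indicator E \<xi>"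
        and dual_value: "p \<le> c + b \<bullet> m - k \<bullet> s"
        using moment_duality[OF S_borel E m s, of p] \<open>?robust\<close> unfolding E_def by metis
      \<comment> \<open>The affine function is the case of a zero deviation weight.\<close>
      have "concave_on S (\<lambda>\<xi>. - d + a \<bullet> \<xi> - 0 \<bullet> \<bar>\<xi> - m\<bar>)"
        by (intro concave_on_abs_deviation S(2)) simp
      then have "concave_on S (\<lambda>\<xi>. a \<bullet> \<xi> - d)"
        by simp
      moreover have "c + b \<bullet> \<xi> - k \<bullet> \<bar>\<xi> - m\<bar> \<le> 0" if "\<xi> \<in> S" "0 < a \<bullet> \<xi> - d" for \<xi>
        using le[OF that(1)] that(2) by (simp add: E_def)
      ultimately obtain r where r: "0 \<le> r"
        "\<And>\<xi>. \<xi> \<in> S \<Longrightarrow> c + b \<bullet> \<xi> - k \<bullet> \<bar>\<xi> - m\<bar> + r * (a \<bullet> \<xi> - d) \<le> 0"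
        using concave_multiplier[OF concave_on_abs_deviation[OF S(2) k, of c b m], of "\<lambda>\<xi>. a \<bullet> \<xi> - d" \<xi>0]
          \<xi>0 by blast
      have "0 \<le> k \<bullet> s"
        using inner_vec_mono[OF k, of 0 s] s by (simp add: less_eq_vec_def less_imp_le)
      have "r \<noteq> 0"
      proof
        assume "r = 0"
        with r(2)[OF mS] abs0 have "c + b \<bullet> m \<le> 0"
          by simp
        with dual_value p(1) \<open>0 \<le> k \<bullet> s\<close> show False
          by simp
      qed
      with r(1) have "0 < r"
        by simp
      have scaled: "c / r + ((1 / r) *\<^sub>R b) \<bullet> \<xi> - ((1 / r) *\<^sub>R k) \<bullet> v = (c + b \<bullet> \<xi> - k \<bullet> v) / r" for \<xi> v
        by (simp add: add_divide_distrib diff_divide_distrib)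
      show ?thesis
      proof (intro exI conjI ballI)
        show "0 \<le> (1 / r) *\<^sub>R k"
          using k r(1) by (simp add: less_eq_vec_def)
        show "0 \<le> 1 / r"
          using r(1) by simp
        show "p * (1 / r) \<le> c / r + ((1 / r) *\<^sub>R b) \<bullet> m - ((1 / r) *\<^sub>R k) \<bullet> s"
          unfolding scaled using dual_value r(1) by (simp add: divide_right_mono)
      next
        fix \<xi> assume "\<xi> \<in> S"
        have "c + b \<bullet> \<xi> - k \<bullet> \<bar>\<xi> - m\<bar> \<le> 1"
          by (rule order_trans[OF le[OF \<open>\<xi> \<in> S\<close>] indicator_le_1])
        then show "c / r + ((1 / r) *\<^sub>R b) \<bullet> \<xi> - ((1 / r) *\<^sub>R k) \<bullet> \<bar>\<xi> - m\<bar> \<le> 1 / r"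
          unfolding scaled using r(1) by (simp add: divide_right_mono)
        show "c / r + ((1 / r) *\<^sub>R b) \<bullet> \<xi> - ((1 / r) *\<^sub>R k) \<bullet> \<bar>\<xi> - m\<bar> \<le> d - a \<bullet> \<xi>"
          unfolding scaled pos_divide_le_eq[OF \<open>0 < r\<close>] using r(2)[OF \<open>\<xi> \<in> S\<close>]
          by (simp add: algebra_simps)
      qed
    qed
  next
    assume ?dual
    then obtain c b k l where k: "0 \<le> k" and "0 \<le> l" and dual_value: "p * l \<le> c + b \<bullet> m - k \<bullet> s"
      and le: "\<And>\<xi>. \<xi> \<in> S \<Longrightarrow> c + b \<bullet> \<xi> - k \<bullet> \<bar>\<xi> - m\<bar> \<le> l"
      and le': "\<And>\<xi>. \<xi> \<in> S \<Longrightarrow> c + b \<bullet> \<xi> - k \<bullet> \<bar>\<xi> - m\<bar> \<le> d - a \<bullet> \<xi>"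
      by blast
    have le_E: "c + b \<bullet> \<xi> - k \<bullet> \<bar>\<xi> - m\<bar> \<le> l * indicator E \<xi>" if "\<xi> \<in> S" for \<xi>
      using le[OF that] le'[OF that] by (auto simp: E_def indicator_def)
    show ?robust
    proof (intro ballI impI)
      fix P assume P: "P \<in> distributions_on S" "(\<integral>\<xi>. \<xi> \<partial>P) = m" "(\<integral>\<xi>. \<bar>\<xi> - m\<bar> \<partial>P) \<le> s"
      interpret prob_space P
        using P(1) by (rule distributions_onD)
      have "p \<le> measure P E"
      proof (cases "l = 0")
        \<comment> \<open>Dividing by \<open>l\<close> is impossible here. Instead Slater's
          condition makes the concave function vanish, and the second bound then says that the
          inequality holds on all of \<open>S\<close>.\<close>
        case True
        then have "c = 0" "b = 0" "k = 0"
          using slater_multipliers_zero[OF m s k, of c b] le dual_value by auto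
        then have "S \<subseteq> E"
          using le' by (auto simp: E_def)
        then have "prob S \<le> prob E"
          using E distributions_onD(2)[OF P(1)] by (intro finite_measure_mono) auto
        with p(2) distributions_onD(3)[OF P(1)] show ?thesis
          by simp
      next
        case False
        have "l * p \<le> l * measure P E"
          using moment_weak_duality[OF S(1) E P k le_E] dual_value by (simp add: mult.commute)
        with False \<open>0 \<le> l\<close> show ?thesis
          by simp
      qed
      then show "p \<le> measure P {\<xi>. a \<bullet> \<xi> \<le> d}"
        by (simp add: E_def)
    qed
  qed
qed

section \<open>Application to the network problem\<close>

text \<open>Needed to read the real infimum as a statement about every distribution. The point mass
  at the mean has zero deviation.\<close>

lemma ambiguity_set_nonempty:
  assumes "mu_vec D \<in> uncertainty_set D" "compact (uncertainty_set D)" "0 \<le> sigma_vec D"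
  shows "ambiguity_set D \<noteq> {}"
proof -
  define P where "P = return borel (mu_vec D)"
  have "(\<lambda>\<xi>. \<bar>\<xi> - mu_vec D\<bar>) \<in> borel_measurable borel"
    by (intro borel_measurable_continuous_onI continuous_on_abs_deviation)
  then have "(\<integral>\<xi>. \<bar>\<xi> - mu_vec D\<bar> \<partial>P) = 0"
    unfolding P_def by (subst integral_return) (auto simp: abs_vec_def vec_eq_iff)
  moreover have "(\<integral>\<xi>. \<xi> \<partial>P) = mu_vec D"
    unfolding P_def by (subst integral_return) auto
  moreover have "P \<in> distributions_on (uncertainty_set D)"
    unfolding P_def distributions_on_def using assms(1) borel_compact[OF assms(2)]
    by (auto simp: prob_space_return measure_return)
  ultimately have "P \<in> ambiguity_set D"
    using assms(3) by (simp add: ambiguity_set_def)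
  then show ?thesis
    by blast
qed

lemma dr_chance_constraint_iff_all:
  assumes "ambiguity_set D \<noteq> {}"
  shows "dr_chance_constraint D x i \<longleftrightarrow>
    (\<forall>P \<in> ambiguity_set D. 1 - eps D i \<le> measure P {\<xi>. cc_a x i \<bullet> \<xi> \<le> cc_b D x i})"
proof -
  have "bdd_below ((\<lambda>P. measure P {\<xi>. cc_a x i \<bullet> \<xi> \<le> cc_b D x i}) ` ambiguity_set D)"
    by (intro bdd_belowI[of _ 0]) auto
  with assms show ?thesis
    unfolding dr_chance_constraint_def by (rule le_cINF_iff)
qed

lemma convex_uncertainty_set: "convex (uncertainty_set D)"
proof -
  have "uncertainty_set D = (\<Inter>w. {\<xi>. U_mat D $ w \<bullet> \<xi> \<le> t_vec D $ w})"
    by (auto simp: uncertainty_set_def less_eq_vec_def matrix_vector_mul_component)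
  then show ?thesis
    by (auto intro: convex_INT convex_halfspace_le)
qed

text \<open>Each of the two bounds over the polytope is dualised separately with the same
  \<open>k\<close>; in the second one \<open>cc_a x i\<close> is first absorbed into the linear
  coefficient.\<close>

lemma ex_aux_constraints_iff:
  fixes D :: "('n::finite, 'l::finite, 'k::finite, 'w::finite) ots_data"
  assumes "uncertainty_set D \<noteq> {}"
  shows "(\<exists>y. aux_constraints D x i y) \<longleftrightarrow>
    (\<exists>c b k l. 0 \<le> k \<and> 0 \<le> l \<and> (1 - eps D i) * l \<le> c + b \<bullet> mu_vec D - k \<bullet> sigma_vec D \<and>
      (\<forall>\<xi>\<in>uncertainty_set D. c + b \<bullet> \<xi> - k \<bullet> \<bar>\<xi> - mu_vec D\<bar> \<le> l) \<and>
      (\<forall>\<xi>\<in>uncertainty_set D. c + b \<bullet> \<xi> - k \<bullet> \<bar>\<xi> - mu_vec D\<bar> \<le> cc_b D x i - cc_a x i \<bullet> \<xi>))"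
    (is "?aux \<longleftrightarrow> ?dual")
proof
  assume ?aux
  then obtain y where y: "aux_constraints D x i y"
    by blast
  have "alpha y + beta y \<bullet> \<xi> - kappa y \<bullet> \<bar>\<xi> - mu_vec D\<bar> \<le> lam y"
    if "\<xi> \<in> uncertainty_set D" for \<xi>
    using y that unfolding aux_constraints_def uncertainty_set_def
    by (intro abs_deviation_weak_dual[where p = "pi1 y" and q = "tau1 y" and y = "psi1 y"]) auto
  moreover have "alpha y + (beta y + cc_a x i) \<bullet> \<xi> - kappa y \<bullet> \<bar>\<xi> - mu_vec D\<bar> \<le> cc_b D x i"
    if "\<xi> \<in> uncertainty_set D" for \<xi>
    using y that unfolding aux_constraints_def uncertainty_set_def
    by (intro abs_deviation_weak_dual[where p = "pi2 y" and q = "tau2 y" and y = "psi2 y"]) auto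
  ultimately show ?dual
    using y unfolding aux_constraints_def
    by (intro exI[of _ "alpha y"] exI[of _ "beta y"] exI[of _ "kappa y"] exI[of _ "lam y"])
      (auto simp: inner_left_distrib algebra_simps)
next
  assume ?dual
  then obtain c b k l where k: "0 \<le> k" and l: "0 \<le> l"
    and dual_value: "(1 - eps D i) * l \<le> c + b \<bullet> mu_vec D - k \<bullet> sigma_vec D"
    and le: "\<And>\<xi>. U_mat D *v \<xi> \<le> t_vec D \<Longrightarrow> c + b \<bullet> \<xi> - k \<bullet> \<bar>\<xi> - mu_vec D\<bar> \<le> l"
    and le': "\<And>\<xi>. U_mat D *v \<xi> \<le> t_vec D \<Longrightarrow>
      c + (b + cc_a x i) \<bullet> \<xi> - k \<bullet> \<bar>\<xi> - mu_vec D\<bar> \<le> cc_b D x i"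
    unfolding uncertainty_set_def by (auto simp: inner_left_distrib algebra_simps)
  obtain \<xi>0 where \<xi>0: "U_mat D *v \<xi>0 \<le> t_vec D"
    using assms by (auto simp: uncertainty_set_def)
  obtain p1 q1 y1 where 1: "0 \<le> p1" "0 \<le> q1" "0 \<le> y1"
    "c + (p1 - q1) \<bullet> mu_vec D + y1 \<bullet> t_vec D \<le> l"
    "b + q1 = p1 + y1 v* U_mat D" "p1 + q1 = k"
    using abs_deviation_dual[OF k \<xi>0 le] .
  obtain p2 q2 y2 where 2: "0 \<le> p2" "0 \<le> q2" "0 \<le> y2"
    "c + (p2 - q2) \<bullet> mu_vec D + y2 \<bullet> t_vec D \<le> cc_b D x i"
    "b + cc_a x i + q2 = p2 + y2 v* U_mat D" "p2 + q2 = k"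
    using abs_deviation_dual[OF k \<xi>0 le'] .
  have "aux_constraints D x i \<lparr>alpha = c, beta = b, kappa = k, lam = l, pi1 = p1, pi2 = p2,
      tau1 = q1, tau2 = q2, psi1 = y1, psi2 = y2\<rparr>"
    using k l dual_value 1 2 by (simp add: aux_constraints_def)
  then show ?aux
    by blast
qed

theorem proposition3:
  fixes D :: "('n::finite, 'l::finite, 'k::finite, 'w::finite) ots_data"
    and P :: "(real ^ 'k) measure"
  assumes "compact (uncertainty_set D)"
    and "aff_dim (uncertainty_set D) = int CARD('k)"
    and "mu_vec D \<in> interior (uncertainty_set D)"
    and "\<And>k. sigma_vec D $ k > 0"
    and "\<And>i. 0 < eps D i \<and> eps D i < 1"
    and "P \<in> distributions_on (uncertainty_set D)" and "(\<integral>\<xi>. \<xi> \<partial>P) = mu_vec D"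
  shows "feasible (drcc_ots D P) = fst ` feasible (reformulation D P) \<and>
         (\<forall>(x, y) \<in> feasible (reformulation D P).
            objective (reformulation D P) (x, y) = objective (drcc_ots D P) x)"
proof -
  have mu: "mu_vec D \<in> uncertainty_set D"
    using assms(3) interior_subset by blast
  then have nonempty: "ambiguity_set D \<noteq> {}"
    using assms(1,4) by (intro ambiguity_set_nonempty) (auto simp: less_eq_vec_def less_imp_le)
  have equiv: "dr_chance_constraint D x i \<longleftrightarrow> (\<exists>y. aux_constraints D x i y)" for x i
  proof -
    have eps: "0 < 1 - eps D i" "1 - eps D i \<le> 1"
      using assms(5)[of i] by auto
    have "dr_chance_constraint D x i \<longleftrightarrow>
        (\<forall>P \<in> distributions_on (uncertainty_set D). (\<integral>\<xi>. \<xi> \<partial>P) = mu_vec D \<longrightarrow>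
          (\<integral>\<xi>. \<bar>\<xi> - mu_vec D\<bar> \<partial>P) \<le> sigma_vec D \<longrightarrow>
          1 - eps D i \<le> measure P {\<xi>. cc_a x i \<bullet> \<xi> \<le> cc_b D x i})"
      unfolding dr_chance_constraint_iff_all[OF nonempty] by (auto simp: ambiguity_set_def)
    also have "\<dots> \<longleftrightarrow> (\<exists>y. aux_constraints D x i y)"
      unfolding robust_chance_iff_concave_bound[OF assms(1) convex_uncertainty_set assms(3,4) eps]
      using mu by (subst ex_aux_constraints_iff) auto
    finally show ?thesis .
  qed
  \<comment> \<open>The auxiliary blocks of different indices share no variables, so they can be
    chosen independently.\<close>
  have "(\<forall>i. dr_chance_constraint D x i) \<longleftrightarrow> (\<exists>y. \<forall>i. aux_constraints D x i (y i))" for x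
    unfolding equiv by (rule choice_iff)
  then have "feasible (drcc_ots D P) = fst ` feasible (reformulation D P)"
    by (force simp: drcc_ots_def reformulation_def)
  then show ?thesis
    by (simp add: drcc_ots_def reformulation_def)
qed

end
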